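(* Let $M$ be a monoid and let $\equiv$ be the equivalence relation on $\mathbf{P}(M)$ defined by $\mathfrak{p}\equiv\mathfrak{p}'$ iff $\mathfrak{p},\mathfrak{p}'$ have the same arity, $\mathrm{first}_1(\mathfrak{p})=\mathrm{first}_1(\mathfrak{p}')$ and $\mathrm{first}_1^{R}(\mathfrak{p})=\mathrm{first}_1^{R}(\mathfrak{p}')$. Then the map $\mathbb{P}_\equiv:=\downarrow_3\circ\downarrow_2\circ\downarrow_1$ is a $\mathbb{P}$-symbol for $\equiv$, and $\mathbb{P}_\equiv(\mathbf{P}(M))$ is the set of $M$-pigmented magnets. Moreover, the graded set $\mathbf{P}(M)/_{\equiv}$ (denoted $\mathsf{Magn}_{1,1}(M)$) is isomorphic to the graded set of $M$-pigmented magnets.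
   Context: Let $(M,\cdot,e)$ be a monoid. An $M$-pigmented letter is a pair written $i^\alpha$ with $i$ a positive integer (value) and $\alpha\in M$ (pigment). $\mathbf{P}(M)(n)$ is the set of words of $M$-pigmented letters with values in $[n]$; $\mathbf{P}(M)=\bigsqcup_n\mathbf{P}(M)(n)$. For a word $\mathfrak{p}$, a position $j$ is a left $1$-witness if no letter of $\mathfrak{p}$ at a position $<j$ has the same value as $\mathfrak{p}(j)$, and a right $1$-witness if no letter at a position $>j$ has the same value as $\mathfrak{p}(j)$. $\mathrm{first}_1(\mathfrak{p})$ (resp. $\mathrm{first}_1^R(\mathfrak{p})$) is the subword of $\mathfrak{p}$ formed by the letters at left (resp. right) $1$-witness positions. Define binary relations on $\mathbf{P}(M)$ (with $\mathfrak{p},\mathfrak{p}'$ arbitrary words and statuses of positions computed in the left-hand word): (1) $\mathfrak{p}\,i^\alpha\,\mathfrak{p}'\leadsto_1\mathfrak{p}\,\mathfrak{p}'$ when the displayed position of $i^\alpha$ is neither a left nor a right $1$-witness; (2) $\mathfrak{p}\,i_1^{\alpha_1}i_2^{\alpha_2}\,\mathfrak{p}'\leadsto_2\mathfrak{p}\,i_2^{\alpha_2}i_1^{\alpha_1}\,\mathfrak{p}'$ when $i_1\ne i_2$, the position of $i_1^{\alpha_1}$ is not a right $1$-witness, and the position of $i_2^{\alpha_2}$ is not a left $1$-witness but is a right $1$-witness; (3) $\mathfrak{p}\,i^\alpha i^\alpha\,\mathfrak{p}'\leadsto_3\mathfrak{p}\,i^\alpha\,\mathfrak{p}'$. Let $\preccurlyeq_j$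 be the reflexive transitive closure of $\leadsto_j$ ($j\in[3]$); it is a partial order and for every $\mathfrak{p}$ there is exactly one maximal element $\mathfrak{q}$ of $(\mathbf{P}(M),\preccurlyeq_j)$ with $\mathfrak{p}\preccurlyeq_j\mathfrak{q}$; denote it $\downarrow_j(\mathfrak{p})$. An $M$-pigmented magnet of arity $n$ is an element of $\mathbf{P}(M)(n)$ that is maximal simultaneously for $\preccurlyeq_1,\preccurlyeq_2,\preccurlyeq_3$. A $\mathbb{P}$-symbol for an equivalence relation $\equiv$ on $\mathbf{P}(M)$ is a map $\mathbb{P}:\mathbf{P}(M)\to\mathbf{P}(M)$ such that $\mathfrak{p}\equiv\mathbb{P}(\mathfrak{p})$ for all $\mathfrak{p}$, and $\mathfrak{p}\equiv\mathfrak{p}'$ implies $\mathbb{P}(\mathfrak{p})=\mathbb{P}(\mathfrak{p}')$. *)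

theory Defs
  imports "HOL-Algebra.Group"
begin

text \<open>A pigmented letter \<open>i\<^sup>\<alpha>\<close> is the pair \<open>(i, \<alpha>)\<close>. As the same word belongs to several arities,
  an element of the graded set \<open>P(M)\<close> is a word tagged with its arity.\<close>

type_synonym 'm letter = "nat \<times> 'm"
type_synonym 'm pword = "nat \<times> 'm letter list"

definition pwords_of_arity :: "('m, 'b) monoid_scheme \<Rightarrow> nat \<Rightarrow> 'm pword set" where
  "pwords_of_arity M n = {n} \<times> lists ({1..n} \<times> carrier M)"

definition pwords :: "('m, 'b) monoid_scheme \<Rightarrow> 'm pword set" where
  "pwords M = (\<Union>n. pwords_of_arity M n)"

text \<open>Positions are counted from \<open>0\<close>, as in the list library.\<close>

definition left_witness :: "'m letter list \<Rightarrow> nat \<Rightarrow> bool" where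
  "left_witness w j \<longleftrightarrow> j < length w \<and> (\<forall>k<j. fst (w ! k) \<noteq> fst (w ! j))"

definition right_witness :: "'m letter list \<Rightarrow> nat \<Rightarrow> bool" where
  "right_witness w j \<longleftrightarrow> j < length w \<and> (\<forall>k. j < k \<and> k < length w \<longrightarrow> fst (w ! k) \<noteq> fst (w ! j))"

definition first_left :: "'m letter list \<Rightarrow> 'm letter list" where
  "first_left w = nths w {j. left_witness w j}"

definition first_right :: "'m letter list \<Rightarrow> 'm letter list" where
  "first_right w = nths w {j. right_witness w j}"

inductive_set step1 :: "('m, 'b) monoid_scheme \<Rightarrow> ('m pword \<times> 'm pword) set"
  for M :: "('m, 'b) monoid_scheme" where
  "\<lbrakk>w = p @ [(i, \<alpha>)] @ p'; (n, w) \<in> pwords M;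
    \<not> left_witness w (length p); \<not> right_witness w (length p)\<rbrakk>
   \<Longrightarrow> ((n, w), (n, p @ p')) \<in> step1 M"

inductive_set step2 :: "('m, 'b) monoid_scheme \<Rightarrow> ('m pword \<times> 'm pword) set"
  for M :: "('m, 'b) monoid_scheme" where
  "\<lbrakk>w = p @ [(i\<^sub>1, \<alpha>\<^sub>1), (i\<^sub>2, \<alpha>\<^sub>2)] @ p'; (n, w) \<in> pwords M; i\<^sub>1 \<noteq> i\<^sub>2;
    \<not> right_witness w (length p);
    \<not> left_witness w (length p + 1); right_witness w (length p + 1)\<rbrakk>
   \<Longrightarrow> ((n, w), (n, p @ [(i\<^sub>2, \<alpha>\<^sub>2), (i\<^sub>1, \<alpha>\<^sub>1)] @ p')) \<in> step2 M"

inductive_set step3 :: "('m, 'b) monoid_scheme \<Rightarrow> ('m pword \<times> 'm pword) set"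
  for M :: "('m, 'b) monoid_scheme" where
  "(n, p @ [(i, \<alpha>), (i, \<alpha>)] @ p') \<in> pwords M
   \<Longrightarrow> ((n, p @ [(i, \<alpha>), (i, \<alpha>)] @ p'), (n, p @ [(i, \<alpha>)] @ p')) \<in> step3 M"

text \<open>In the next two definitions, \<open>R\<close> is one of the rewrite relations above, and the order
  considered on \<open>P(M)\<close> is its reflexive transitive closure.\<close>

definition maximal_pword ::
  "('m, 'b) monoid_scheme \<Rightarrow> ('m pword \<times> 'm pword) set \<Rightarrow> 'm pword \<Rightarrow> bool" where
  "maximal_pword M R q \<longleftrightarrow> q \<in> pwords M \<and> (\<forall>q'\<in>pwords M. (q, q') \<in> R\<^sup>* \<longrightarrow> q' = q)"

definition down ::
  "('m, 'b) monoid_scheme \<Rightarrow> ('m pword \<times> 'm pword) set \<Rightarrow> 'm pword \<Rightarrow> 'm pword" where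
  "down M R p = (THE q. maximal_pword M R q \<and> (p, q) \<in> R\<^sup>*)"

definition magnets :: "('m, 'b) monoid_scheme \<Rightarrow> nat \<Rightarrow> 'm pword set" where
  "magnets M n = {q \<in> pwords_of_arity M n.
     maximal_pword M (step1 M) q \<and> maximal_pword M (step2 M) q \<and> maximal_pword M (step3 M) q}"

definition is_P_symbol ::
  "('m, 'b) monoid_scheme \<Rightarrow> ('m pword \<times> 'm pword) set \<Rightarrow> ('m pword \<Rightarrow> 'm pword) \<Rightarrow> bool" where
  "is_P_symbol M E f \<longleftrightarrow> equiv (pwords M) E \<and> f \<in> pwords M \<rightarrow> pwords M \<and>
     (\<forall>p\<in>pwords M. (p, f p) \<in> E) \<and>
     (\<forall>p\<in>pwords M. \<forall>p'\<in>pwords M. (p, p') \<in> E \<longrightarrow> f p = f p')"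

definition magn_equiv :: "('m, 'b) monoid_scheme \<Rightarrow> ('m pword \<times> 'm pword) set" where
  "magn_equiv M = {(p, p'). p \<in> pwords M \<and> p' \<in> pwords M \<and> fst p = fst p' \<and>
     first_left (snd p) = first_left (snd p') \<and> first_right (snd p) = first_right (snd p')}"

definition magn_P_symbol :: "('m, 'b) monoid_scheme \<Rightarrow> 'm pword \<Rightarrow> 'm pword" where
  "magn_P_symbol M = down M (step3 M) \<circ> down M (step2 M) \<circ> down M (step1 M)"

text \<open>Equivalent words have the same arity, so every class of the quotient of \<open>P(M)\<close> lies in
  exactly one of these components.\<close>

definition Magn_1_1 :: "('m, 'b) monoid_scheme \<Rightarrow> nat \<Rightarrow> 'm pword set set" where
  "Magn_1_1 M n = pwords_of_arity M n // magn_equiv M"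

definition graded_set_isomorphic :: "(nat \<Rightarrow> 'a set) \<Rightarrow> (nat \<Rightarrow> 'b set) \<Rightarrow> bool" where
  "graded_set_isomorphic A B \<longleftrightarrow> (\<exists>f. \<forall>n. bij_betw (f n) (A n) (B n))"

end

theory Submission
  imports Defs "HOL-Library.Sublist" "HOL-Library.Multiset"
begin

text \<open>
  All three rewrite steps preserve the words of left and of right witnesses, so everything reduces
  to two claims. The image of the composite consists of magnets, because \<open>\<leadsto>\<^sub>3\<close> creates no new
  redex of the two other relations once every value occurs at most twice. And a magnet is determined
  by its two witness words: after doubling every letter whose value occurs once, each value occurs
  exactly twice, so the next letter is read off either from the left or from the right witness word.
  If two such words diverge, one continues with a left witness where the other continues with a right
  witness \<open>y\<close> whose value was already seen; in the first word, \<open>y\<close> is then eventually preceded by a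
  left witness with which it could be swapped.
\<close>

section \<open>Witnesses and the two witness words, described through sets of values\<close>

abbreviation vals :: "'m letter list \<Rightarrow> nat set" where
  "vals w \<equiv> fst ` set w"

abbreviation occs :: "'m letter list \<Rightarrow> nat \<Rightarrow> nat" where
  "occs w a \<equiv> count_list (map fst w) a"

lemma in_vals_iff: "a \<in> vals w \<longleftrightarrow> occs w a > 0"
  by (metis count_list_0_iff gr0I less_not_refl list.set_map)

lemma notin_vals_iff: "a \<notin> vals w \<longleftrightarrow> occs w a = 0"
  by (simp add: in_vals_iff)

lemma filter_nths: "filter P (nths w A) = nths w {j \<in> A. P (w ! j)}"
  by (induction w arbitrary: A) (auto simp: nths_Cons)

lemma left_witness_append_Cons:
  "left_witness (p @ x # p') (length p) \<longleftrightarrow> fst x \<notin> vals p"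
proof -
  have "left_witness (p @ x # p') (length p) \<longleftrightarrow> (\<forall>k<length p. fst (p ! k) \<noteq> fst x)"
    by (simp add: left_witness_def nth_append)
  also have "\<dots> \<longleftrightarrow> (\<forall>z\<in>set p. fst z \<noteq> fst x)" by (simp add: all_set_conv_all_nth)
  finally show ?thesis by (auto simp: image_iff)
qed

lemma right_witness_Cons_0: "right_witness (x # w) 0 \<longleftrightarrow> fst x \<notin> vals w"
proof -
  have "right_witness (x # w) 0 \<longleftrightarrow> (\<forall>k<length w. fst (w ! k) \<noteq> fst x)"
    unfolding right_witness_def by (auto simp: nth_Cons' all_conj_distrib dest: spec[of _ "Suc _"])
  also have "\<dots> \<longleftrightarrow> (\<forall>z\<in>set w. fst z \<noteq> fst x)" by (simp add: all_set_conv_all_nth)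
  finally show ?thesis by (auto simp: image_iff)
qed

lemma right_witness_Cons_Suc: "right_witness (x # w) (Suc j) \<longleftrightarrow> right_witness w j"
  unfolding right_witness_def by (simp add: All_less_Suc2 nth_Cons split: nat.split)

lemma right_witness_append:
  "right_witness (p @ w) (length p + j) \<longleftrightarrow> right_witness w j"
  by (induction p) (simp_all add: right_witness_Cons_Suc)

lemma right_witness_append_Cons:
  "right_witness (p @ x # p') (length p) \<longleftrightarrow> fst x \<notin> vals p'"
  using right_witness_append[of p "x # p'" 0] by (simp add: right_witness_Cons_0)

lemma left_witness_Cons_0: "left_witness (x # w) 0"
  by (simp add: left_witness_def)

lemma left_witness_Cons_Suc:
  "left_witness (x # w) (Suc j) \<longleftrightarrow> left_witness w j \<and> fst (w ! j) \<noteq> fst x"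
  unfolding left_witness_def by (auto simp: All_less_Suc2)

lemma first_left_Nil [simp]: "first_left [] = []"
  and first_right_Nil [simp]: "first_right [] = []"
  by (simp_all add: first_left_def first_right_def)

text \<open>Putting \<open>x\<close> in front destroys exactly the left witnesses sharing its value,
  hence the filter. Right witnesses of \<open>w\<close> look only forward and survive, so the right
  word at most gains a head.\<close>

lemma first_left_Cons [simp]:
  "first_left (x # w) = x # filter (\<lambda>y. fst y \<noteq> fst x) (first_left w)"
  by (simp add: first_left_def nths_Cons left_witness_Cons_0 left_witness_Cons_Suc filter_nths)

lemma first_right_Cons [simp]:
  "first_right (x # w) = (if fst x \<in> vals w then first_right w else x # first_right w)"
  by (simp add: first_right_def nths_Cons right_witness_Cons_0 right_witness_Cons_Suc)

lemma vals_first_left: "vals (first_left w) = vals w"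
  by (induction w) (fastforce simp: image_iff)+

lemma first_left_append:
  "first_left (u @ v) = first_left u @ filter (\<lambda>y. fst y \<notin> vals u) (first_left v)"
  by (induction u) (auto intro!: filter_cong)

lemma first_right_append:
  "first_right (u @ v) = filter (\<lambda>y. fst y \<notin> vals v) (first_right u) @ first_right v"
  by (induction u) auto

section \<open>The rewrite steps\<close>

text \<open>The side conditions of \<open>step2\<close> without positions. As \<open>x\<close> and
  \<open>y\<close> have different values, neither affects the witness status of the other, so only
  the contexts \<open>p\<close> and \<open>p'\<close> enter.\<close>

definition swappable ::
  "'m letter list \<Rightarrow> 'm letter \<Rightarrow> 'm letter \<Rightarrow> 'm letter list \<Rightarrow> bool" where
  "swappable p x y p' \<longleftrightarrow>
     fst x \<noteq> fst y \<and> fst x \<in> vals p' \<and> fst y \<in> vals p \<and> fst y \<notin> vals p'"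

definition swap_free :: "'m letter list \<Rightarrow> bool" where
  "swap_free w \<longleftrightarrow> (\<forall>p x y p'. w = p @ x # y # p' \<longrightarrow> \<not> swappable p x y p')"

lemma swap_freeD: "swap_free (p @ x # y # p') \<Longrightarrow> \<not> swappable p x y p'"
  unfolding swap_free_def by blast

lemma pwords_iff: "(n, w) \<in> pwords M \<longleftrightarrow> set w \<subseteq> {1..n} \<times> carrier M"
  by (auto simp: pwords_def pwords_of_arity_def)

lemma pwords_mono: "(n, w) \<in> pwords M \<Longrightarrow> set v \<subseteq> set w \<Longrightarrow> (n, v) \<in> pwords M"
  unfolding pwords_iff by (rule subset_trans)

lemma step1_iff:
  "((n, w), q) \<in> step1 M \<longleftrightarrow> (n, w) \<in> pwords M \<and>
     (\<exists>p x p'. w = p @ x # p' \<and> fst x \<in> vals p \<and> fst x \<in> vals p' \<and> q = (n, p @ p'))"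
  (is "?L \<longleftrightarrow> ?R")
proof
  assume ?L
  then obtain p i \<alpha> p' where "w = p @ (i, \<alpha>) # p'" "i \<in> vals p" "i \<in> vals p'"
    "q = (n, p @ p')" "(n, w) \<in> pwords M"
    by (cases q) (auto simp: step1.simps left_witness_append_Cons right_witness_append_Cons)
  then show ?R by (intro conjI exI[of _ p] exI[of _ "(i, \<alpha>)"] exI[of _ p']) simp_all
next
  assume ?R
  then obtain p x p' where "w = p @ x # p'" "fst x \<in> vals p" "fst x \<in> vals p'"
    "q = (n, p @ p')" "(n, w) \<in> pwords M" by blast
  then show ?L
    using step1.intros[of w p "fst x" "snd x" p' n M]
    by (simp add: left_witness_append_Cons right_witness_append_Cons)
qed

lemma step2_iff:
  "((n, w), q) \<in> step2 M \<longleftrightarrow> (n, w) \<in> pwords M \<and>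
     (\<exists>p x y p'. w = p @ x # y # p' \<and> swappable p x y p' \<and> q = (n, p @ y # x # p'))"
  (is "?L \<longleftrightarrow> ?R")
proof -
  have *: "left_witness (p @ x # y # p') (Suc (length p)) \<longleftrightarrow> fst y \<notin> insert (fst x) (vals p)"
    "right_witness (p @ x # y # p') (Suc (length p)) \<longleftrightarrow> fst y \<notin> vals p'"
    for p p' :: "'a letter list" and x y
    using left_witness_append_Cons[of "p @ [x]" y p'] right_witness_append_Cons[of "p @ [x]" y p']
    by simp_all
  show ?thesis
  proof
    assume ?L
    then obtain p i \<alpha> j \<beta> p' where "w = p @ (i, \<alpha>) # (j, \<beta>) # p'" "q = (n, p @ (j, \<beta>) # (i, \<alpha>) # p')"
      "(n, w) \<in> pwords M" "swappable p (i, \<alpha>) (j, \<beta>) p'"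
      by (cases q) (auto simp: step2.simps right_witness_append_Cons * swappable_def)
    then show ?R by blast
  next
    assume ?R
    then obtain p x y p' where "w = p @ x # y # p'" "q = (n, p @ y # x # p')"
      "(n, w) \<in> pwords M" "swappable p x y p'"
      by blast
    then show ?L
      using step2.intros[of w p "fst x" "snd x" "fst y" "snd y" p' n M]
      by (simp add: right_witness_append_Cons * swappable_def)
  qed
qed

lemma step3_iff:
  "((n, w), q) \<in> step3 M \<longleftrightarrow> (n, w) \<in> pwords M \<and>
     (\<exists>p x p'. w = p @ x # x # p' \<and> q = (n, p @ x # p'))"
  by (cases q) (auto simp: step3.simps)

lemma step1E:
  assumes "(q, r) \<in> step1 M"
  obtains n p x p' where "q = (n, p @ x # p')" "r = (n, p @ p')" "fst x \<in> vals p" "fst x \<in> vals p'"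
proof -
  obtain n w where q: "q = (n, w)" by (cases q)
  from assms[unfolded q step1_iff] that show thesis unfolding q by blast
qed

lemma step2E:
  assumes "(q, r) \<in> step2 M"
  obtains n p x y p' where "q = (n, p @ x # y # p')" "r = (n, p @ y # x # p')" "swappable p x y p'"
proof -
  obtain n w where q: "q = (n, w)" by (cases q)
  from assms[unfolded q step2_iff] that show thesis unfolding q by blast
qed

lemma step3E:
  assumes "(q, r) \<in> step3 M"
  obtains n p x p' where "q = (n, p @ x # x # p')" "r = (n, p @ x # p')"
proof -
  obtain n w where q: "q = (n, w)" by (cases q)
  from assms[unfolded q step3_iff] that show thesis unfolding q by blast
qed

lemma steps_in_pwords:
  "step1 M \<subseteq> pwords M \<times> pwords M"
  "step2 M \<subseteq> pwords M \<times> pwords M"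
  "step3 M \<subseteq> pwords M \<times> pwords M"
  by (auto simp: step1_iff step2_iff step3_iff elim!: pwords_mono)

section \<open>Invariance of the witness words under the rewrite steps\<close>

text \<open>The copy of the value in \<open>p\<close> keeps \<open>x\<close> out of the left word
  and the copy in \<open>p'\<close> keeps it out of the right word. These copies also hide the same
  later, respectively earlier, letters as \<open>x\<close> did.\<close>

lemma first_delete:
  assumes "fst x \<in> vals p" "fst x \<in> vals p'"
  shows "first_left (p @ x # p') = first_left (p @ p')"
    and "first_right (p @ x # p') = first_right (p @ p')"
proof -
  have *: "fst y \<noteq> fst x \<and> fst y \<notin> vals u \<longleftrightarrow> fst y \<notin> vals u" if "fst x \<in> vals u" for u y
    using that by metis
  show "first_left (p @ x # p') = first_left (p @ p')"
    "first_right (p @ x # p') = first_right (p @ p')"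
    using assms by (simp_all add: first_left_append first_right_append *)
qed

text \<open>The left word omits \<open>y\<close>, whose value occurs in \<open>p\<close>, and the
  right word omits \<open>x\<close>, whose value occurs in \<open>p'\<close>. Each word sees at most
  one of the two letters, so their order is invisible.\<close>

lemma first_swap:
  assumes "swappable p x y p'"
  shows "first_left (p @ y # x # p') = first_left (p @ x # y # p')"
    and "first_right (p @ y # x # p') = first_right (p @ x # y # p')"
  using assms
  by (simp_all add: swappable_def first_left_append first_right_append insert_commute conj_commute
      conj_left_commute)

lemma first_double:
  shows "first_left (p @ x # x # p') = first_left (p @ x # p')"
    and "first_right (p @ x # x # p') = first_right (p @ x # p')"
  by (simp_all add: first_left_append first_right_append)

lemma steps_in_magn_equiv:
  "step1 M \<subseteq> magn_equiv M"
  "step2 M \<subseteq> magn_equiv M"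
  "step3 M \<subseteq> magn_equiv M"
proof -
  have *: "p \<in> pwords M \<and> q \<in> pwords M" if "(p, q) \<in> step1 M \<union> step2 M \<union> step3 M" for p q
    using that steps_in_pwords[of M] by blast
  have "(p, q) \<in> magn_equiv M" if "(p, q) \<in> step1 M" for p q
    using that by (rule step1E) (use *[of p q] that in \<open>simp add: magn_equiv_def first_delete\<close>)
  moreover have "(p, q) \<in> magn_equiv M" if "(p, q) \<in> step2 M" for p q
    using that by (rule step2E) (use *[of p q] that in \<open>simp add: magn_equiv_def first_swap\<close>)
  moreover have "(p, q) \<in> magn_equiv M" if "(p, q) \<in> step3 M" for p q
    using that by (rule step3E) (use *[of p q] that in \<open>simp add: magn_equiv_def first_double\<close>)
  ultimately show "step1 M \<subseteq> magn_equiv M" "step2 M \<subseteq> magn_equiv M" "step3 M \<subseteq> magn_equiv M"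
    by auto
qed

lemma equiv_magn_equiv: "equiv (pwords M) (magn_equiv M)"
  by (auto simp: magn_equiv_def intro!: equivI refl_onI symI transI)

lemma steps_irrefl:
  "(p, p) \<notin> step1 M" "(p, p) \<notin> step2 M" "(p, p) \<notin> step3 M"
  by (cases p; auto simp: step1_iff step2_iff step3_iff swappable_def)+

section \<open>Maximal words\<close>

text \<open>An applicable step leads to a different word because \<open>R\<close> is irreflexive,
  while outside the domain of \<open>R\<close> only the empty path starts. Maximality thus becomes
  absence of redexes.\<close>

lemma maximal_pword_iff:
  assumes "\<And>p. (p, p) \<notin> R" "R \<subseteq> pwords M \<times> pwords M"
  shows "maximal_pword M R q \<longleftrightarrow> q \<in> pwords M \<and> q \<notin> Domain R"
  unfolding maximal_pword_def using assms
  by (blast elim: converse_rtranclE)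

lemmas maximal_step_iff =
  maximal_pword_iff[OF steps_irrefl(1) steps_in_pwords(1)]
  maximal_pword_iff[OF steps_irrefl(2) steps_in_pwords(2)]
  maximal_pword_iff[OF steps_irrefl(3) steps_in_pwords(3)]

lemma maximal_step1_iff:
  "maximal_pword M (step1 M) (n, w) \<longleftrightarrow> (n, w) \<in> pwords M \<and>
     (\<forall>p x p'. w = p @ x # p' \<longrightarrow> fst x \<in> vals p \<longrightarrow> fst x \<notin> vals p')"
  unfolding maximal_step_iff Domain_iff step1_iff by blast

lemma maximal_step2_iff:
  "maximal_pword M (step2 M) (n, w) \<longleftrightarrow> (n, w) \<in> pwords M \<and> swap_free w"
  unfolding maximal_step_iff Domain_iff step2_iff swap_free_def by blast

lemma not_distinct_adj_iff: "\<not> distinct_adj w \<longleftrightarrow> (\<exists>p x p'. w = p @ x # x # p')"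
proof
  show "\<not> distinct_adj w \<Longrightarrow> \<exists>p x p'. w = p @ x # x # p'"
  proof (induction w)
    case (Cons z w)
    show ?case
    proof (cases "distinct_adj w")
      case True
      then obtain w' where "w = z # w'" using Cons.prems by (cases w) auto
      then show ?thesis by (intro exI[of _ "[]"]) simp
    next
      case False
      then obtain p x p' where "w = p @ x # x # p'" using Cons.IH by blast
      then show ?thesis by (intro exI[of _ "z # p"]) simp
    qed
  qed simp
qed (auto simp: distinct_adj_append_iff)

lemma maximal_step3_iff:
  "maximal_pword M (step3 M) (n, w) \<longleftrightarrow> (n, w) \<in> pwords M \<and> distinct_adj w"
  using not_distinct_adj_iff[of w] unfolding maximal_step_iff Domain_iff step3_iff by blast

text \<open>With three occurrences of a value, the second one is neither a left nor a right witness
  and could be deleted.\<close>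

lemma maximal_step1_occs:
  assumes "maximal_pword M (step1 M) (n, w)"
  shows "occs w a \<le> 2"
proof (rule ccontr)
  assume *: "\<not> occs w a \<le> 2"
  then have "a \<in> vals w" by (simp add: in_vals_iff)
  then obtain p x q where 1: "w = p @ x # q" "a = fst x" "a \<notin> vals p"
    using split_list_first[of a "map fst w"] by (auto simp: map_eq_append_conv)
  then have "occs q a > 1" using * by (simp add: notin_vals_iff)
  then have "a \<in> vals q" by (simp add: in_vals_iff)
  then obtain q1 y q2 where 2: "q = q1 @ y # q2" "a = fst y" "a \<notin> vals q1"
    using split_list_first[of a "map fst q"] by (auto simp: map_eq_append_conv)
  then have "a \<in> vals q2" using \<open>occs q a > 1\<close> by (simp add: notin_vals_iff in_vals_iff)
  moreover have "fst y \<notin> vals q2"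
    by (rule assms[unfolded maximal_step1_iff, THEN conjunct2, rule_format, of "p @ x # q1"])
      (use 1 2 in simp_all)
  ultimately show False using 2 by simp
qed

lemma occs_maximal_step1:
  assumes "(n, w) \<in> pwords M" "\<And>a. occs w a \<le> 2"
  shows "maximal_pword M (step1 M) (n, w)"
  unfolding maximal_step1_iff
proof (intro conjI allI impI notI)
  fix p x p' assume "w = p @ x # p'" "fst x \<in> vals p" "fst x \<in> vals p'"
  then show False using assms(2)[of "fst x"] by (simp add: in_vals_iff)
qed (rule assms)

section \<open>Uniqueness of swap-free words\<close>

text \<open>The letter \<open>y\<close> is the first right witness of the word and \<open>x\<close>
  is not one. So \<open>y\<close> has a predecessor \<open>z\<close>, and \<open>z\<close> is not a
  right witness.\<close>

lemma first_right_ConsE: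
  assumes "first_right (x # u) = y # r" "fst x \<in> vals u"
  obtains p z u' where "x # u = p @ z # y # u'" "fst z \<in> vals (y # u')" "fst y \<notin> vals u'"
  using assms
proof (induction u arbitrary: x thesis)
  case (Cons v u)
  show ?case
  proof (cases "fst v \<in> vals u")
    case True
    then obtain p z u' where "v # u = p @ z # y # u'" "fst z \<in> vals (y # u')" "fst y \<notin> vals u'"
      using Cons by (metis first_right_Cons)
    then show ?thesis using Cons.prems(1)[of "x # p"] by simp
  next
    case False
    then show ?thesis using Cons.prems(1)[of "[]" x u] Cons.prems(2,3) by simp
  qed
qed simp

text \<open>The hypotheses describe two words that part after \<open>s\<close>, with
  \<open>x\<close> still to recur and \<open>y\<close> at its last occurrence. The right words force
  \<open>y\<close> to be the next right witness after \<open>s\<close> in the first word too; its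
  predecessor there can be swapped with it.\<close>

lemma swap_free_no_divergence:
  assumes w: "swap_free (s @ x # u)"
    and le2: "\<And>a. occs (s @ x # u) a \<le> 2"
    and vals: "vals (x # u) = vals (y # u')"
    and right: "first_right (s @ x # u) = first_right (s @ y # u')"
    and x: "fst x \<in> vals u"
    and y: "fst y \<in> vals s" "fst y \<notin> vals u'"
  shows False
proof -
  \<comment> \<open>The contribution of \<open>s\<close> depends only on the values of the tail,
    which agree, so it cancels.\<close>
  have "first_right (x # u) = first_right (y # u')"
    using right unfolding first_right_append vals by (rule same_append_eq[THEN iffD1])
  also have "\<dots> = y # first_right u'" using y by simp
  finally obtain p z v where v: "x # u = p @ z # y # v" "fst z \<in> vals (y # v)" "fst y \<notin> vals v"
    using x by (rule first_right_ConsE)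
  \<comment> \<open>Equality would give three occurrences of this value: one in \<open>s\<close>,
    then \<open>z\<close>, then \<open>y\<close>.\<close>
  have "fst z \<noteq> fst y"
    using le2[of "fst y"] y(1) unfolding v(1) by (auto simp: in_vals_iff)
  then have "swappable (s @ p) z y v" using v y by (auto simp: swappable_def)
  then show False using w swap_freeD[of "s @ p" z y v] by (simp add: v(1))
qed

text \<open>Equal counts give equal lengths, so distinct words have a first point of divergence with
  tails of equal value sets. The witness words and the bound two leave there only the situation of
  \<open>swap_free_no_divergence\<close>, up to exchanging the words.\<close>

lemma swap_free_unique:
  assumes "swap_free w" "swap_free w'"
    and le2: "\<And>a. occs w a \<le> 2" and occs: "\<And>a. occs w a = occs w' a"
    and left: "first_left w = first_left w'" and right: "first_right w = first_right w'"
  shows "w = w'"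
proof (rule ccontr)
  assume "w \<noteq> w'"
  have le2': "occs w' a \<le> 2" for a using le2[of a] occs[of a] by simp
  have "mset (map fst w) = mset (map fst w')"
    using occs by (intro multiset_eqI) (simp only: count_mset)
  then have len: "length w = length w'" by (metis length_map size_mset)
  have "\<not> prefix w w'" "\<not> prefix w' w"
    using \<open>w \<noteq> w'\<close> len by (auto simp: prefix_def)
  then obtain s x u y u' where s: "w = s @ x # u" "w' = s @ y # u'" "x \<noteq> y"
    using parallel_decomp[of w w'] by blast
  have rest: "occs (x # u) a = occs (y # u') a" for a
    using occs[of a] unfolding s by simp
  have "a \<in> vals (x # u) \<longleftrightarrow> a \<in> vals (y # u')" for a by (simp only: in_vals_iff rest)
  then have vals: "vals (x # u) = vals (y # u')" by blast
  \<comment> \<open>If both values were new after \<open>s\<close>, then \<open>x\<close> and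
    \<open>y\<close> would both be the next letter of the same left word.\<close>
  have L: "\<not> (fst x \<notin> vals s \<and> fst y \<notin> vals s)"
    using left \<open>x \<noteq> y\<close> unfolding s by (auto simp: first_left_append split: if_splits)
  \<comment> \<open>If both were last occurrences, both would head the same right word of the
    tails.\<close>
  have R: "\<not> (fst x \<notin> vals u \<and> fst y \<notin> vals u')"
  proof -
    have "first_right (x # u) = first_right (y # u')"
      using right unfolding s first_right_append vals by (rule same_append_eq[THEN iffD1])
    then show ?thesis using \<open>x \<noteq> y\<close> by (auto split: if_splits)
  qed
  have x: "fst x \<in> vals s \<Longrightarrow> fst x \<notin> vals u"
    using le2[of "fst x"] unfolding s by (simp add: in_vals_iff)
  have y: "fst y \<in> vals s \<Longrightarrow> fst y \<notin> vals u'"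
    using le2'[of "fst y"] unfolding s by (simp add: in_vals_iff)
  \<comment> \<open>If \<open>x\<close> is new, \<open>L\<close> makes \<open>y\<close> an old
    value, hence at its last occurrence, and \<open>R\<close> makes \<open>x\<close> recur. If
    \<open>x\<close> is old, it is at its last occurrence and \<open>R\<close> makes
    \<open>y\<close> recur.\<close>
  consider "fst x \<in> vals u" "fst y \<in> vals s" "fst y \<notin> vals u'"
    | "fst y \<in> vals u'" "fst x \<in> vals s" "fst x \<notin> vals u"
    using L R x y by blast
  then show False
  proof cases
    case 1
    then show False using swap_free_no_divergence[of s x u y u'] assms(1) le2 right vals unfolding s by blast
  next
    case 2
    then show False using swap_free_no_divergence[of s y u' x u] assms(2) le2' right[symmetric] vals[symmetric]
      unfolding s by blast
  qed
qed

section \<open>Doubling the letters that occur once\<close>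

text \<open>The set \<open>S\<close> is a parameter, rather than computed from \<open>w\<close>, so
  that it stays fixed in inductions on \<open>w\<close>. The copies are adjacent, so
  \<open>remdups_adj\<close> can undo the doubling.\<close>

definition double_vals :: "nat set \<Rightarrow> 'm letter list \<Rightarrow> 'm letter list" where
  "double_vals S w = concat (map (\<lambda>x. if fst x \<in> S then [x, x] else [x]) w)"

lemma double_vals_simps [simp]:
  "double_vals S [] = []"
  "double_vals S (x # w) = (if fst x \<in> S then [x, x] else [x]) @ double_vals S w"
  by (simp_all add: double_vals_def)

lemma vals_double_vals [simp]: "vals (double_vals S w) = vals w"
  by (induction w) auto

lemma first_left_double_vals: "first_left (double_vals S w) = first_left w"
  by (induction w) auto

lemma first_right_double_vals: "first_right (double_vals S w) = first_right w"
  by (induction w) auto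

lemma remdups_adj_double_vals: "remdups_adj (double_vals S w) = remdups_adj w"
  by (induction w) (auto simp: remdups_adj_Cons split: list.split)

lemma occs_double_vals: "occs (double_vals S w) a = (if a \<in> S then 2 else 1) * occs w a"
  by (induction w) auto

text \<open>Neighbours of different values cannot be the two copies of one letter, so they come from
  neighbours in \<open>w\<close>. An extra copy of \<open>x\<close> may end \<open>p\<close> and one
  of \<open>y\<close> may start \<open>p'\<close>, which is why the inclusions hold only up to these
  letters.\<close>

lemma double_vals_adjacentE:
  assumes "double_vals S w = p @ x # y # p'" "fst x \<noteq> fst y"
  obtains q q' where "w = q @ x # y # q'" "vals p \<subseteq> vals (q @ [x])"
    "vals q' \<subseteq> vals p'" "vals p' \<subseteq> vals (y # q')"
proof -
  have first: "\<exists>q'. w = y # q' \<and> vals q' \<subseteq> vals p' \<and> vals p' \<subseteq> vals (y # q')"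
    if eq: "double_vals S w = y # p'" for w
  proof -
    obtain v where v: "w = y # v" "p' = (if fst y \<in> S then y # double_vals S v else double_vals S v)"
      using eq by (cases w) (auto split: if_splits)
    show ?thesis by (rule exI[of _ v]) (simp add: v subset_insertI)
  qed
  have "\<exists>q q'. w = q @ x # y # q' \<and> vals p \<subseteq> vals (q @ [x]) \<and>
      vals q' \<subseteq> vals p' \<and> vals p' \<subseteq> vals (y # q')"
    using assms
  proof (induction w arbitrary: p)
    case (Cons z w)
    \<comment> \<open>Either the pair lies entirely behind the copies of \<open>z\<close>, or it
      straddles the border behind them; then \<open>z = x\<close> and \<open>p\<close> holds at most
      the other copy of \<open>x\<close>.\<close>
    have "(\<exists>r. vals p \<subseteq> insert (fst z) (vals r) \<and> double_vals S w = r @ x # y # p') \<or>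
      (z = x \<and> double_vals S w = y # p' \<and> vals p \<subseteq> {fst x})"
    proof (cases p)
      case Nil
      then show ?thesis using Cons.prems by (cases "fst z \<in> S") auto
    next
      case p: (Cons z' r)
      show ?thesis
      proof (cases "fst z \<in> S")
        case True
        show ?thesis
        proof (cases r)
          case Nil
          then show ?thesis using True Cons.prems(1) by (auto simp: p)
        next
          case r: (Cons z'' r')
          then have "vals p \<subseteq> insert (fst z) (vals r') \<and> double_vals S w = r' @ x # y # p'"
            using True Cons.prems(1) by (auto simp: p)
          then show ?thesis by blast
        qed
      next
        case False
        then have "vals p \<subseteq> insert (fst z) (vals r) \<and> double_vals S w = r @ x # y # p'"
          using Cons.prems by (simp add: p)
        then show ?thesis by blast
      qed
    qed
    then show ?case
    proof (elim disjE exE conjE)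
      fix r assume r: "vals p \<subseteq> insert (fst z) (vals r)" "double_vals S w = r @ x # y # p'"
      obtain q q' where q: "w = q @ x # y # q'" "vals r \<subseteq> vals (q @ [x])"
        "vals q' \<subseteq> vals p'" "vals p' \<subseteq> vals (y # q')"
        using Cons.IH[OF r(2) Cons.prems(2)] by (elim exE conjE)
      have "insert (fst z) (vals r) \<subseteq> vals ((z # q) @ [x])"
        using insert_mono[OF q(2), of "fst z"] by (simp add: insert_commute)
      with r(1) have "vals p \<subseteq> vals ((z # q) @ [x])" by (rule subset_trans)
      moreover have "z # w = (z # q) @ x # y # q'" using q(1) by simp
      ultimately show ?thesis using q(3,4) by (intro exI[of _ "z # q"] exI[of _ q'] conjI)
    next
      assume *: "z = x" "double_vals S w = y # p'" "vals p \<subseteq> {fst x}"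
      obtain q' where "w = y # q'" "vals q' \<subseteq> vals p'" "vals p' \<subseteq> vals (y # q')"
        using first[OF *(2)] by (elim exE conjE)
      then show ?thesis using * by (intro exI[of _ "[]"] exI[of _ q']) simp
    qed
  qed simp
  then show ?thesis by (elim exE conjE) (rule that)
qed

text \<open>A swappable pair pulls back to \<open>w\<close>. The condition on \<open>y\<close> in
  the prefix ignores an extra \<open>x\<close>, and the condition on \<open>x\<close> in the suffix
  ignores an extra \<open>y\<close>.\<close>

lemma swap_free_double_vals:
  assumes "swap_free w"
  shows "swap_free (double_vals S w)"
  unfolding swap_free_def
proof (intro allI impI notI)
  fix p x y p' assume eq: "double_vals S w = p @ x # y # p'" and sw: "swappable p x y p'"
  from sw have "fst x \<noteq> fst y" by (simp add: swappable_def)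
  with eq obtain q q' where q: "w = q @ x # y # q'" "vals p \<subseteq> vals (q @ [x])"
    "vals q' \<subseteq> vals p'" "vals p' \<subseteq> vals (y # q')"
    by (rule double_vals_adjacentE)
  have "fst y \<in> vals (q @ [x])" "fst x \<in> vals (y # q')" "fst y \<notin> vals q'"
    using sw q(2-4) unfolding swappable_def by (metis subsetD)+
  then have "swappable q x y q'" using \<open>fst x \<noteq> fst y\<close> by (auto simp: swappable_def)
  then show False using assms unfolding q(1) by (simp add: swap_freeD)
qed

text \<open>A value might occur once in \<open>w\<close> and twice in \<open>w'\<close>, so
  \<open>swap_free_unique\<close> does not apply directly. Doubling levels the counts, and having no
  equal neighbours lets \<open>remdups_adj\<close> recover both words.\<close>

lemma reduced_swap_free_unique:
  assumes "swap_free w" "\<And>a. occs w a \<le> 2" "distinct_adj w"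
    and "swap_free w'" "\<And>a. occs w' a \<le> 2" "distinct_adj w'"
    and left: "first_left w = first_left w'" and right: "first_right w = first_right w'"
  shows "w = w'"
proof -
  define D where "D u = double_vals {a. occs u a = 1} u" for u :: "'a letter list"
  \<comment> \<open>After doubling, the counts depend only on the set of values, which the left word
    determines.\<close>
  have D: "occs (D u) a = (if a \<in> vals u then 2 else 0)" if "\<And>a. occs u a \<le> 2" for u a
    using that[of a] by (auto simp: D_def occs_double_vals in_vals_iff)
  have vals: "vals w = vals w'" using left vals_first_left[of w] vals_first_left[of w'] by simp
  have "D w = D w'"
  proof (rule swap_free_unique)
    show "swap_free (D w)" "swap_free (D w')"
      using assms(1,4) by (simp_all add: D_def swap_free_double_vals)
    show "occs (D w) a \<le> 2" "occs (D w) a = occs (D w') a" for a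
      unfolding D[OF assms(2)] D[OF assms(5)] vals by simp_all
    show "first_left (D w) = first_left (D w')" "first_right (D w) = first_right (D w')"
      using left right by (simp_all add: D_def first_left_double_vals first_right_double_vals)
  qed
  then have "remdups_adj w = remdups_adj w'" unfolding D_def by (metis remdups_adj_double_vals)
  then show ?thesis using assms by (simp add: distinct_adj_altdef)
qed

section \<open>Normal forms\<close>

text \<open>The decreasing measure \<open>f\<close> provides a reachable maximal word; with
  \<open>uniq\<close>, the description in \<open>down\<close> is well defined.\<close>

lemma down_maximal:
  fixes f :: "'m pword \<Rightarrow> nat"
  assumes R: "R \<subseteq> pwords M \<times> pwords M" and dec: "\<And>p q. (p, q) \<in> R \<Longrightarrow> f q < f p"
    and p: "p \<in> pwords M"
    and uniq: "\<And>q q'. maximal_pword M R q \<Longrightarrow> maximal_pword M R q' \<Longrightarrow>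
      (p, q) \<in> R\<^sup>* \<Longrightarrow> (p, q') \<in> R\<^sup>* \<Longrightarrow> q = q'"
  shows "maximal_pword M R (down M R p)" "(p, down M R p) \<in> R\<^sup>*"
proof -
  have iff: "maximal_pword M R q \<longleftrightarrow> q \<in> pwords M \<and> q \<notin> Domain R" for q
    using dec by (intro maximal_pword_iff R) blast
  have "\<exists>q. maximal_pword M R q \<and> (p, q) \<in> R\<^sup>*"
    using p
  proof (induction p rule: measure_induct_rule[of f])
    case (less p)
    show ?case
    proof (cases "p \<in> Domain R")
      case True
      then obtain r where r: "(p, r) \<in> R" by blast
      then obtain q where "maximal_pword M R q" "(r, q) \<in> R\<^sup>*"
        using less.IH[of r] dec R by blast
      then show ?thesis using r by (meson converse_rtrancl_into_rtrancl)
    qed (use less.prems iff in blast)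
  qed
  then have "\<exists>!q. maximal_pword M R q \<and> (p, q) \<in> R\<^sup>*" using uniq by blast
  then show "maximal_pword M R (down M R p)" "(p, down M R p) \<in> R\<^sup>*"
    unfolding down_def by (metis (mono_tags, lifting) theI')+
qed

lemma down_eq_self:
  assumes "maximal_pword M R q"
    and "R \<subseteq> pwords M \<times> pwords M"
  shows "down M R q = q"
proof -
  have "r \<in> pwords M" if "(q, r) \<in> R\<^sup>*" for r
    using that assms by (induction rule: rtrancl_induct) (auto simp: maximal_pword_def)
  then show ?thesis
    unfolding down_def using assms by (intro the_equality) (auto simp: maximal_pword_def)
qed

lemma rtrancl_invariant:
  assumes "(p, q) \<in> R\<^sup>*" "\<And>p q. (p, q) \<in> R \<Longrightarrow> g p = g q"
  shows "g p = g q"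
  using assms(1) by (induction rule: rtrancl_induct) (simp_all add: assms(2))

lemma rtrancl_magn_equiv:
  assumes "(p, q) \<in> R\<^sup>*" "R \<subseteq> magn_equiv M" "p \<in> pwords M"
  shows "(p, q) \<in> magn_equiv M"
  using assms(1)
proof (induction rule: rtrancl_induct)
  case base
  then show ?case using assms(3) by (simp add: magn_equiv_def)
next
  case (step q r)
  then have "(q, r) \<in> magn_equiv M" using assms(2) by blast
  then show ?case using step.IH by (simp add: magn_equiv_def)
qed

section \<open>Normal forms for deletion\<close>

text \<open>Computes the normal form for \<open>step1\<close> in one pass, with \<open>S\<close>
  collecting the values already read. Looking ahead in the unpruned rest is safe, as the last
  occurrence is always kept.\<close>

fun prune :: "nat set \<Rightarrow> 'm letter list \<Rightarrow> 'm letter list" where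
  "prune S [] = []"
| "prune S (x # w) =
     (if fst x \<in> S \<and> fst x \<in> vals w then prune S w else x # prune (insert (fst x) S) w)"

lemma prune_delete:
  assumes "fst x \<in> S \<union> vals p" "fst x \<in> vals p'"
  shows "prune S (p @ x # p') = prune S (p @ p')"
  using assms
proof (induction p arbitrary: S)
  case (Cons z p)
  have "vals (p @ x # p') = vals (p @ p')" using Cons.prems(2) by auto
  then show ?case using Cons by auto
qed simp

lemma prune_eq_self:
  assumes "\<And>p x p'. w = p @ x # p' \<Longrightarrow> fst x \<in> S \<union> vals p \<Longrightarrow> fst x \<notin> vals p'"
  shows "prune S w = w"
  using assms
proof (induction w arbitrary: S)
  case (Cons z w)
  have "prune (insert (fst z) S) w = w"
  proof (rule Cons.IH)
    fix p x p' assume "w = p @ x # p'" "fst x \<in> insert (fst z) S \<union> vals p"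
    then show "fst x \<notin> vals p'" using Cons.prems[of "z # p" x p'] by simp
  qed
  then show ?case using Cons.prems[of "[]" z w] by (cases "fst z \<in> S") simp_all
qed simp

lemma down_step1:
  assumes "p \<in> pwords M"
  shows "maximal_pword M (step1 M) (down M (step1 M) p)" "(p, down M (step1 M) p) \<in> (step1 M)\<^sup>*"
proof -
  \<comment> \<open>This map is constant along steps and fixes maximal words, so every maximal word
    reachable from \<open>p\<close> equals \<open>?g p\<close>.\<close>
  let ?g = "\<lambda>p. (fst p, prune {} (snd p))"
  have inv: "?g q = ?g r" if "(q, r) \<in> step1 M" for q r
    using that by (rule step1E) (simp add: prune_delete)
  have max: "?g q = q" if "maximal_pword M (step1 M) q" for q
  proof -
    obtain n w where q: "q = (n, w)" by (cases q)
    have "prune {} w = w"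
      by (rule prune_eq_self, rule that[unfolded q maximal_step1_iff, THEN conjunct2, rule_format])
        simp_all
    then show ?thesis by (simp add: q)
  qed
  have uniq: "q = q'"
    if "maximal_pword M (step1 M) q" "maximal_pword M (step1 M) q'"
      "(p, q) \<in> (step1 M)\<^sup>*" "(p, q') \<in> (step1 M)\<^sup>*" for q q'
    using max[OF that(1)] max[OF that(2)]
      rtrancl_invariant[of _ _ _ ?g, OF that(3) inv] rtrancl_invariant[of _ _ _ ?g, OF that(4) inv]
    by metis
  have dec: "length (snd r) < length (snd q)" if "(q, r) \<in> step1 M" for q r
    using that by (rule step1E) simp
  show "maximal_pword M (step1 M) (down M (step1 M) p)" "(p, down M (step1 M) p) \<in> (step1 M)\<^sup>*"
    using down_maximal[OF steps_in_pwords(1) dec assms uniq] by simp_all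
qed

section \<open>Normal forms for merging, computed by \<open>remdups_adj\<close>\<close>

lemma remdups_adj_merge: "remdups_adj (p @ x # x # p') = remdups_adj (p @ x # p')"
proof (induction p)
  case (Cons z p)
  then show ?case using remdups_adj_Cons[of z "p @ x # x # p'"] remdups_adj_Cons[of z "p @ x # p'"]
    by simp
qed simp

lemma down_step3:
  assumes "p \<in> pwords M"
  shows "maximal_pword M (step3 M) (down M (step3 M) p)" "(p, down M (step3 M) p) \<in> (step3 M)\<^sup>*"
proof -
  let ?g = "\<lambda>p. (fst p, remdups_adj (snd p))"
  have inv: "?g q = ?g r" if "(q, r) \<in> step3 M" for q r
    using that by (rule step3E) (simp add: remdups_adj_merge)
  have max: "?g q = q" if "maximal_pword M (step3 M) q" for q
    using that by (cases q) (simp add: maximal_step3_iff distinct_adj_altdef)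
  have uniq: "q = q'"
    if "maximal_pword M (step3 M) q" "maximal_pword M (step3 M) q'"
      "(p, q) \<in> (step3 M)\<^sup>*" "(p, q') \<in> (step3 M)\<^sup>*" for q q'
    using max[OF that(1)] max[OF that(2)]
      rtrancl_invariant[of _ _ _ ?g, OF that(3) inv] rtrancl_invariant[of _ _ _ ?g, OF that(4) inv]
    by metis
  have dec: "length (snd r) < length (snd q)" if "(q, r) \<in> step3 M" for q r
    using that by (rule step3E) simp
  show "maximal_pword M (step3 M) (down M (step3 M) p)" "(p, down M (step3 M) p) \<in> (step3 M)\<^sup>*"
    using down_maximal[OF steps_in_pwords(3) dec assms uniq] by simp_all
qed

section \<open>Normal forms for swapping\<close>

text \<open>The sum of the positions of the right witnesses; a swap moves one of them to the left.\<close>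

primrec right_weight :: "'m letter list \<Rightarrow> nat" where
  "right_weight [] = 0"
| "right_weight (x # w) = right_weight w + length (first_right w)"

text \<open>Of the suffixes starting at the two exchanged positions, the longer keeps its right word
  and the shorter loses the right witness \<open>y\<close>. Suffixes starting inside
  \<open>p\<close> keep theirs.\<close>

lemma right_weight_swap:
  assumes "swappable p x y p'"
  shows "right_weight (p @ y # x # p') < right_weight (p @ x # y # p')"
proof -
  have first: "first_right (y # x # p') = first_right (x # y # p')"
    using assms by (simp add: swappable_def)
  have "right_weight (y # x # p') < right_weight (x # y # p')"
    using assms by (simp add: swappable_def)
  then show ?thesis
    by (induction p) (simp_all add: first_right_append first insert_commute)
qed

lemma occs_step2: "(p, q) \<in> step2 M \<Longrightarrow> occs (snd p) = occs (snd q)"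
  by (erule step2E) (simp add: fun_eq_iff)

text \<open>Swaps preserve the counts and the witness words, so \<open>swap_free_unique\<close>
  identifies all reachable maximal words once no value occurs more than twice.\<close>

lemma down_step2:
  assumes "p \<in> pwords M" and le2: "\<And>a. occs (snd p) a \<le> 2"
  shows "maximal_pword M (step2 M) (down M (step2 M) p)" "(p, down M (step2 M) p) \<in> (step2 M)\<^sup>*"
proof -
  have uniq: "q = q'"
    if max: "maximal_pword M (step2 M) q" "maximal_pword M (step2 M) q'"
      and steps: "(p, q) \<in> (step2 M)\<^sup>*" "(p, q') \<in> (step2 M)\<^sup>*" for q q'
  proof -
    have occs: "occs (snd p) = occs (snd r)" if "(p, r) \<in> (step2 M)\<^sup>*" for r
      using that by (rule rtrancl_invariant[of _ _ _ "\<lambda>p. occs (snd p)"]) (rule occs_step2)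
    have sf: "swap_free (snd q)" "swap_free (snd q')"
      using max by (metis maximal_step2_iff prod.collapse)+
    have eqv: "(p, q) \<in> magn_equiv M" "(p, q') \<in> magn_equiv M"
      using steps assms(1) by (simp_all add: rtrancl_magn_equiv[OF _ steps_in_magn_equiv(2)])
    have "snd q = snd q'"
    proof (rule swap_free_unique[OF sf])
      show "occs (snd q) a \<le> 2" "occs (snd q) a = occs (snd q') a" for a
        using occs[OF steps(1)] occs[OF steps(2)] le2[of a] by simp_all
    qed (use eqv in \<open>simp_all add: magn_equiv_def\<close>)
    then show ?thesis using eqv by (intro prod_eqI) (simp_all add: magn_equiv_def)
  qed
  have dec: "right_weight (snd r) < right_weight (snd q)" if "(q, r) \<in> step2 M" for q r
    using that by (rule step2E) (simp add: right_weight_swap)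
  show "maximal_pword M (step2 M) (down M (step2 M) p)" "(p, down M (step2 M) p) \<in> (step2 M)\<^sup>*"
    using down_maximal[OF steps_in_pwords(2) dec assms(1) uniq] by simp_all
qed

section \<open>Merging creates no new redexes\<close>

text \<open>A new redex could arise only because the surviving \<open>z\<close> became a right
  witness and is the second letter of the pair. Its value would then also occur before the pair,
  giving three occurrences before the merge.\<close>

lemma swap_free_merge:
  assumes sf: "swap_free (p @ z # z # p')" and le2: "occs (p @ z # z # p') (fst z) \<le> 2"
  shows "swap_free (p @ z # p')"
  unfolding swap_free_def
proof (intro allI impI notI)
  fix q x y q' assume eq: "p @ z # p' = q @ x # y # q'" and sw: "swappable q x y q'"
  from eq consider (right) r where "p = q @ x # y # r" "q' = r @ z # p'"
    | (second) "p = q @ [x]" "z = y" "p' = q'"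
    | (first) "p = q" "z = x" "p' = y # q'"
    | (left) r where "q = p @ z # r" "p' = r @ x # y # q'"
    by (auto simp: append_eq_append_conv2 append_eq_Cons_conv Cons_eq_append_conv)
  then show False
  proof cases
    case right
    then have "swappable q x y (r @ z # z # p')" using sw by (simp add: swappable_def)
    then show False using sf swap_freeD[of q x y "r @ z # z # p'"] right by simp
  next
    case second
    then show False using sw le2 by (simp add: swappable_def in_vals_iff)
  next
    case first
    then have "swappable (p @ [z]) x y q'" using sw by (simp add: swappable_def)
    then show False using sf swap_freeD[of "p @ [z]" x y q'] first by simp
  next
    case left
    then have "swappable (p @ z # z # r) x y q'" using sw by (simp add: swappable_def)
    then show False using sf swap_freeD[of "p @ z # z # r" x y q'] left by simp
  qed
qed

lemma rtrancl_step3_invariant: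
  assumes "(p, q) \<in> (step3 M)\<^sup>*" "swap_free (snd p)" "\<And>a. occs (snd p) a \<le> 2"
  shows "swap_free (snd q) \<and> (\<forall>a. occs (snd q) a \<le> 2)"
  using assms(1)
proof (induction rule: rtrancl_induct)
  case (step q r)
  from step.hyps(2) obtain n u x v where q: "q = (n, u @ x # x # v)" and r: "r = (n, u @ x # v)"
    by (rule step3E)
  have le2: "occs (u @ x # x # v) a \<le> 2" for a using step.IH by (simp add: q)
  have "occs (u @ x # v) a \<le> 2" for a using le2[of a] by (simp split: if_splits)
  then show ?case using step.IH swap_free_merge[OF _ le2] by (simp add: q r)
qed (use assms in simp)

section \<open>Magnets\<close>

lemma mem_magnets_iff:
  "(n, w) \<in> (\<Union>n. magnets M n) \<longleftrightarrow>
     (n, w) \<in> pwords M \<and> (\<forall>a. occs w a \<le> 2) \<and> swap_free w \<and> distinct_adj w"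
proof -
  have "(n, w) \<in> (\<Union>n. magnets M n) \<longleftrightarrow> maximal_pword M (step1 M) (n, w) \<and>
      maximal_pword M (step2 M) (n, w) \<and> maximal_pword M (step3 M) (n, w)"
    by (auto simp: magnets_def pwords_of_arity_def maximal_pword_def pwords_def)
  then show ?thesis
    using maximal_step1_occs[of M n w] occs_maximal_step1[of n w M]
    by (auto simp: maximal_step2_iff maximal_step3_iff)
qed

text \<open>Deletion bounds the counts by two, and swaps preserve them. This bound makes the swap
  normal form unique and lets merging keep the word swap-free.\<close>

lemma magn_P_symbol_magnet:
  assumes p: "p \<in> pwords M"
  shows "magn_P_symbol M p \<in> (\<Union>n. magnets M n)" "(p, magn_P_symbol M p) \<in> magn_equiv M"
proof -
  define q1 where "q1 = down M (step1 M) p"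
  define q2 where "q2 = down M (step2 M) q1"
  define q3 where "q3 = down M (step3 M) q2"
  note q1 = down_step1[OF p, folded q1_def]
  have q1_pword: "q1 \<in> pwords M" using q1(1) by (simp add: maximal_pword_def)
  have le2: "occs (snd q1) a \<le> 2" for a
    using maximal_step1_occs[of M "fst q1" "snd q1"] q1(1) by simp
  note q2 = down_step2[OF q1_pword le2, folded q2_def]
  have q2_pword: "q2 \<in> pwords M" using q2(1) by (simp add: maximal_pword_def)
  have "occs (snd q1) = occs (snd q2)"
    using q2(2) by (rule rtrancl_invariant[of _ _ _ "\<lambda>p. occs (snd p)"]) (rule occs_step2)
  then have le2': "occs (snd q2) a \<le> 2" for a using le2[of a] by simp
  have sf: "swap_free (snd q2)" using q2(1) maximal_step2_iff[of M "fst q2" "snd q2"] by simp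
  note q3 = down_step3[OF q2_pword, folded q3_def]
  have "(fst q3, snd q3) \<in> (\<Union>n. magnets M n)"
    using rtrancl_step3_invariant[OF q3(2) sf le2'] q3(1) maximal_step3_iff[of M "fst q3" "snd q3"]
    unfolding mem_magnets_iff by simp
  moreover have "(p, q3) \<in> magn_equiv M"
    using rtrancl_magn_equiv[OF q1(2) steps_in_magn_equiv(1) p]
      rtrancl_magn_equiv[OF q2(2) steps_in_magn_equiv(2) q1_pword]
      rtrancl_magn_equiv[OF q3(2) steps_in_magn_equiv(3) q2_pword]
    by (simp add: magn_equiv_def)
  ultimately show "magn_P_symbol M p \<in> (\<Union>n. magnets M n)" "(p, magn_P_symbol M p) \<in> magn_equiv M"
    by (simp_all add: magn_P_symbol_def q1_def q2_def q3_def)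
qed

lemma magn_P_symbol_eq_self:
  assumes "q \<in> magnets M n"
  shows "magn_P_symbol M q = q"
  using assms by (simp add: magnets_def magn_P_symbol_def down_eq_self steps_in_pwords)

lemma magnets_unique:
  assumes "q \<in> (\<Union>n. magnets M n)" "q' \<in> (\<Union>n. magnets M n)" "(q, q') \<in> magn_equiv M"
  shows "q = q'"
proof -
  obtain n w m w' where "q = (n, w)" "q' = (m, w')" by (cases q, cases q')
  then show ?thesis
    using assms mem_magnets_iff[of n w M] mem_magnets_iff[of m w' M] reduced_swap_free_unique[of w w']
    by (simp add: magn_equiv_def)
qed

section \<open>The P-symbol property, its image, and the isomorphism of graded sets\<close>

theorem theorem5p1p8:
  fixes M :: "('m, 'b) monoid_scheme" (structure)
  assumes "monoid M"
  shows "is_P_symbol M (magn_equiv M) (magn_P_symbol M) \<and>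
    magn_P_symbol M ` pwords M = (\<Union>n. magnets M n) \<and>
    graded_set_isomorphic (Magn_1_1 M) (magnets M)"
proof (intro conjI)
  let ?E = "magn_equiv M" and ?P = "magn_P_symbol M"
  note eqv = equiv_magn_equiv[of M]
  have mag_pword: "(\<Union>n. magnets M n) \<subseteq> pwords M"
    by (auto simp: magnets_def pwords_def)
  \<comment> \<open>Both images are magnets equivalent to their arguments, hence to each other, and
    equivalent magnets coincide.\<close>
  have P_eq: "?P p = ?P p'" if "(p, p') \<in> ?E" for p p'
  proof -
    have pp': "p \<in> pwords M" "p' \<in> pwords M" using that by (auto simp: magn_equiv_def)
    then have "(?P p, ?P p') \<in> ?E"
      using that magn_P_symbol_magnet(2)[of p M] magn_P_symbol_magnet(2)[of p' M]
      by (simp add: magn_equiv_def)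
    then show ?thesis
      by (rule magnets_unique[OF magn_P_symbol_magnet(1)[OF pp'(1)] magn_P_symbol_magnet(1)[OF pp'(2)]])
  qed
  show "is_P_symbol M ?E ?P"
    unfolding is_P_symbol_def
  proof (intro conjI ballI impI Pi_I)
    show "?P p \<in> pwords M" if "p \<in> pwords M" for p
      using magn_P_symbol_magnet(1)[OF that] mag_pword by (rule rev_subsetD)
  qed (use eqv P_eq magn_P_symbol_magnet(2) in simp_all)
  show "?P ` pwords M = (\<Union>n. magnets M n)"
  proof
    show "?P ` pwords M \<subseteq> (\<Union>n. magnets M n)" using magn_P_symbol_magnet(1) by blast
    show "(\<Union>n. magnets M n) \<subseteq> ?P ` pwords M"
    proof
      fix q assume q: "q \<in> (\<Union>n. magnets M n)"
      then have "?P q = q" using magn_P_symbol_eq_self by blast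
      then show "q \<in> ?P ` pwords M" using q mag_pword by (metis imageI subsetD)
    qed
  qed
  have arity: "p \<in> pwords_of_arity M n \<longleftrightarrow> p \<in> pwords M \<and> fst p = n" for p n
    by (auto simp: pwords_def pwords_of_arity_def)
  have mag_arity: "q \<in> magnets M n \<longleftrightarrow> q \<in> (\<Union>n. magnets M n) \<and> fst q = n" for q n
    by (auto simp: magnets_def pwords_of_arity_def)
  have class_image: "?P ` (?E `` {q}) = {q}" if "q \<in> magnets M n" for q n
  proof -
    have q: "?P q = q" using that by (rule magn_P_symbol_eq_self)
    have "q \<in> pwords M" using that mag_pword by blast
    then have "q \<in> ?E `` {q}" by (simp add: magn_equiv_def)
    then have "(\<lambda>r. q) ` (?E `` {q}) = {q}" by (rule image_constant)
    moreover have "?P ` (?E `` {q}) = (\<lambda>r. q) ` (?E `` {q})"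
      using P_eq[of q] q by (intro image_cong) simp_all
    ultimately show ?thesis by simp
  qed
  \<comment> \<open>A class is sent to the single value that the P-symbol takes on it, extracted by
    \<open>the_elem\<close>; the inverse sends a magnet to its class.\<close>
  have "bij_betw (\<lambda>c. the_elem (?P ` c)) (Magn_1_1 M n) (magnets M n)" for n
  proof (rule bij_betw_byWitness[where f' = "\<lambda>q. ?E `` {q}"])
    \<comment> \<open>The magnet in the class of \<open>p\<close> is \<open>?P p\<close>, which has
      the same arity.\<close>
    have rep: "\<exists>q \<in> magnets M n. c = ?E `` {q}" if "c \<in> Magn_1_1 M n" for c
    proof -
      from that obtain p where p: "p \<in> pwords M" "fst p = n" "c = ?E `` {p}"
        by (auto simp: Magn_1_1_def quotient_def arity)
      have "(p, ?P p) \<in> ?E" using p by (intro magn_P_symbol_magnet(2))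
      then have "c = ?E `` {?P p}" "fst (?P p) = n"
        using equiv_class_eq[OF eqv] p by (auto simp: magn_equiv_def)
      then show ?thesis using magn_P_symbol_magnet(1)[OF p(1)] mag_arity by blast
    qed
    show "\<forall>c\<in>Magn_1_1 M n. ?E `` {the_elem (?P ` c)} = c"
      using rep class_image by (metis the_elem_eq)
    show "\<forall>q\<in>magnets M n. the_elem (?P ` (?E `` {q})) = q"
      using class_image by simp
    show "(\<lambda>c. the_elem (?P ` c)) ` Magn_1_1 M n \<subseteq> magnets M n"
    proof
      fix d assume "d \<in> (\<lambda>c. the_elem (?P ` c)) ` Magn_1_1 M n"
      then obtain c where c: "c \<in> Magn_1_1 M n" "d = the_elem (?P ` c)" by blast
      from rep[OF c(1)] obtain q where "q \<in> magnets M n" "c = ?E `` {q}" ..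
      then show "d \<in> magnets M n" by (simp add: c(2) class_image)
    qed
    show "(\<lambda>q. ?E `` {q}) ` magnets M n \<subseteq> Magn_1_1 M n"
      by (auto simp: Magn_1_1_def magnets_def intro!: quotientI)
  qed
  then show "graded_set_isomorphic (Magn_1_1 M) (magnets M)"
    unfolding graded_set_isomorphic_def by (intro exI allI)
qed

end
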